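(* Let $A\subset\mathbb{R}$ be open and let $\{F_\alpha\}_{\alpha\in A}$ be a family of set-valued mappings $F_\alpha:\mathbb{R}\to\mathcal{K}(\mathbb{R})$ satisfying the standing hypotheses (H1)--(H5) listed in the context, with extremal maps $f_\alpha^-(x)=\min F_\alpha(x)$ and $f_\alpha^+(x)=\max F_\alpha(x)$. For a fixed $\alpha_0\in A$, let $E_{\alpha_0}=[e_1,e_2]$ be a minimal invariant set of $F_{\alpha_0}$. If $\{F_\alpha\}_{\alpha\in A}$ topologically bifurcates at $E_{\alpha_0}$, then at least one of the four conditions $$\left|\frac{\mathrm{d} f^-_{\alpha_0}}{\mathrm{d}x}(e_1)\right|\ge 1,\quad \left|\frac{\mathrm{d} f^+_{\alpha_0}}{\mathrm{d}x}(e_1)\right|\ge 1,\quad \left|\frac{\mathrm{d} f^-_{\alpha_0}}{\mathrm{d}x}(e_2)\right|\ge 1,\quad \left|\frac{\mathrm{d} f^+_{\alpha_0}}{\mathrm{d}x}(e_2)\right|\ge 1$$ is satisfied.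
   Context: $\mathcal{K}(\mathbb{R})$ is the set of all nonempty compact subsets of $\mathbb{R}$. For $x\in\mathbb{R}$ and $S,T\subset\mathbb{R}$, $\operatorname{dist}(x,S)=\inf\{|x-y|:y\in S\}$, $d(S|T)=\sup\{\operatorname{dist}(x,T):x\in S\}$, and the Hausdorff distance is $h(S,T)=\max\{d(S|T),d(T|S)\}$ (with the convention $\inf\emptyset=+\infty$, $\sup\emptyset=0$ should one of the sets be empty). $\mathcal{K}(\mathbb{R})$ is equipped with $h$. For a set-valued mapping $F$ and a set $S$, $F(S)=\bigcup_{x\in S}F(x)$. Standing hypotheses. For every $\alpha\in A$, the mapping $F=F_\alpha:\mathbb{R}\to\mathcal{K}(\mathbb{R})$ satisfies: (H1) $F(x)$ is an interval for all $x\in\mathbb{R}$. (H2) There exists $\varepsilon>0$ such that $F(x)$ contains an interval of length $\varepsilon$ for all $x\in\mathbb{R}$. (H3) The extremal maps $f^-(x)=\min F(x)$ and $f^+(x)=\max F(x)$ are continuously differentiable on $\mathbb{R}$. The family satisfies: (H4) The mapping $(\alpha,x)\mapsto F_\alpha(x)$ is continuous on $A\times\mathbb{R}$. (H5) The mapping $\alpha\mapsto F_\alpha(x)$ is continuous at every $\alpha\in A$, uniformly in $x\in\mathbb{R}$. A set $E\in\mathcal{K}(\mathbb{R})$ is a minimal invariant set for $F$ if $F(E)=E$ and $E$ does not contain any proper nonempty subset (in $\mathcal{K}(\mathbb{R})$) with this property. $\mathcal{M}_\alpha$ denotes the union of all minimal invariant sets of $F_\alpha$. The family $\{F_\alpha\}_{\alpha\in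 A}$ topologically bifurcates at a minimal invariant set $E_{\alpha_0}$ of $F_{\alpha_0}$ if for any neighborhood $U$ of $E_{\alpha_0}$, the mapping $\alpha\mapsto U\cap\mathcal{M}_\alpha$ is discontinuous at $\alpha_0$ in Hausdorff distance. *)

theory Defs
  imports "HOL-Analysis.Analysis"
begin

text \<open>
  Distances take values in \<^typ>\<open>ennreal\<close>, where the infimum over the empty set is \<open>\<infinity>\<close> and
  the supremum over the empty set is \<open>0\<close>. The library's \<^const>\<open>infdist\<close> and \<^const>\<open>setdist\<close>
  are \<open>0\<close> for an empty set instead.
\<close>

definition dist_to_set :: "real \<Rightarrow> real set \<Rightarrow> ennreal" where
  "dist_to_set x S = (INF y\<in>S. ennreal \<bar>x - y\<bar>)"

definition hausdorff_semidist :: "real set \<Rightarrow> real set \<Rightarrow> ennreal" where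
  "hausdorff_semidist S T = (SUP x\<in>S. dist_to_set x T)"

definition hausdorff_dist :: "real set \<Rightarrow> real set \<Rightarrow> ennreal" where
  "hausdorff_dist S T = max (hausdorff_semidist S T) (hausdorff_semidist T S)"

definition nonempty_compacts :: "real set set" where
  "nonempty_compacts = {S. compact S \<and> S \<noteq> {}}"

text \<open>Continuity at \<open>p\<close>, relative to the domain \<open>S\<close>, with respect to the Hausdorff distance.\<close>

definition hausdorff_continuous_at ::
    "'a::topological_space set \<Rightarrow> ('a \<Rightarrow> real set) \<Rightarrow> 'a \<Rightarrow> bool" where
  "hausdorff_continuous_at S G p \<longleftrightarrow>
     (\<forall>\<epsilon>>0. \<forall>\<^sub>F q in at p within S. hausdorff_dist (G q) (G p) < ennreal \<epsilon>)"

definition set_image :: "(real \<Rightarrow> real set) \<Rightarrow> real set \<Rightarrow> real set" where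
  "set_image F S = (\<Union>x\<in>S. F x)"

text \<open>On nonempty compact values, the infimum and supremum are the minimum and maximum.\<close>

definition lower_map :: "(real \<Rightarrow> real set) \<Rightarrow> real \<Rightarrow> real" where
  "lower_map F x = Inf (F x)"

definition upper_map :: "(real \<Rightarrow> real set) \<Rightarrow> real \<Rightarrow> real" where
  "upper_map F x = Sup (F x)"

definition minimal_invariant :: "(real \<Rightarrow> real set) \<Rightarrow> real set \<Rightarrow> bool" where
  "minimal_invariant F E \<longleftrightarrow>
     E \<in> nonempty_compacts \<and> set_image F E = E \<and>
     (\<forall>E'\<in>nonempty_compacts. E' \<subset> E \<longrightarrow> set_image F E' \<noteq> E')"

definition minimal_union :: "(real \<Rightarrow> real set) \<Rightarrow> real set" where
  "minimal_union F = \<Union>{E. minimal_invariant F E}"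

text \<open>A neighborhood of \<open>E\<close> is any set, not necessarily open, whose interior contains \<open>E\<close>.\<close>

definition topologically_bifurcates ::
    "real set \<Rightarrow> (real \<Rightarrow> real \<Rightarrow> real set) \<Rightarrow> real \<Rightarrow> real set \<Rightarrow> bool" where
  "topologically_bifurcates A F \<alpha>\<^sub>0 E \<longleftrightarrow>
     (\<forall>U. E \<subseteq> interior U \<longrightarrow>
        \<not> hausdorff_continuous_at A (\<lambda>\<alpha>. U \<inter> minimal_union (F \<alpha>)) \<alpha>\<^sub>0)"

end

theory Submission
  imports Defs
begin

text \<open>
  The contrapositive holds because endpoint derivatives of modulus below 1 make
  \<open>E = [e\<^sub>1, e\<^sub>2]\<close> an attractor that survives perturbation. Since \<open>F(E) = E\<close>, the extremal maps send \<open>E\<close> into \<open>E\<close>; if all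
  four endpoint derivatives have modulus below some \<open>c < 1\<close>, then leaving \<open>E\<close> by at most \<open>t\<close> changes
  an extremal map by at most \<open>c t\<close>. Hence \<open>F\<close> maps \<open>[e\<^sub>1 - t, e\<^sub>2 + t]\<close> into
  \<open>[e\<^sub>1 - c t, e\<^sub>2 + c t]\<close> for all small \<open>t\<close> (lemma \<open>endpoint_contraction\<close>). Choose as neighbourhood
  one such interval \<open>U\<close>. A map \<open>\<eta>\<close>-close to \<open>F\<close> still maps \<open>U\<close> into itself, which has three
  consequences.

  \<^item> It has a minimal invariant set inside \<open>U\<close>, by Zorn's lemma
    (\<open>exists_minimal_invariant\<close>), and each of its minimal invariant sets that meets \<open>U\<close> lies in \<open>U\<close>
    (\<open>minimal_invariant_trapped\<close>).

  \<^item> An invariant set inside \<open>U\<close> that protrudes from \<open>E\<close> by \<open>t\<close> satisfies \<open>t \<le> c t + \<eta>\<close>, so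
    it lies within \<open>\<eta> / (1 - c)\<close> of \<open>E\<close> (\<open>invariant_near_contracting\<close>).

  \<^item> Such a set comes close to every point of \<open>E\<close>: sets that are forward invariant for nearby maps
    accumulate on a subset of \<open>E\<close> that is forward invariant for \<open>F\<close>, and by minimality this is all
    of \<open>E\<close> (\<open>forward_invariant_hits_minimal\<close>).

  The last two facts bound the two halves of the Hausdorff distance between \<open>E\<close> and the part in \<open>U\<close>
  of the union of minimal invariant sets, so that part varies continuously.
\<close>

section \<open>Hausdorff distance\<close>

lemma hausdorff_dist_commute: "hausdorff_dist S T = hausdorff_dist T S"
  by (simp add: hausdorff_dist_def max.commute)

lemma hausdorff_dist_less_near:
  assumes "hausdorff_dist S T < ennreal \<eta>" "x \<in> S"
  shows "\<exists>y\<in>T. \<bar>x - y\<bar> < \<eta>"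
proof -
  have "dist_to_set x T \<le> hausdorff_semidist S T"
    unfolding hausdorff_semidist_def using assms(2) by (rule SUP_upper)
  also have "\<dots> < ennreal \<eta>"
    using assms(1) by (simp add: hausdorff_dist_def)
  finally obtain y where "y \<in> T" "ennreal \<bar>x - y\<bar> < ennreal \<eta>"
    unfolding dist_to_set_def INF_less_iff by blast
  then show ?thesis
    by (auto simp: ennreal_less_iff)
qed

lemma hausdorff_semidist_le:
  assumes "\<And>x. x \<in> S \<Longrightarrow> \<exists>y\<in>T. \<bar>x - y\<bar> \<le> \<eta>"
  shows "hausdorff_semidist S T \<le> ennreal \<eta>"
  unfolding hausdorff_semidist_def
proof (rule SUP_least)
  fix x assume "x \<in> S"
  then obtain y where "y \<in> T" "\<bar>x - y\<bar> \<le> \<eta>"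
    using assms by blast
  then show "dist_to_set x T \<le> ennreal \<eta>"
    unfolding dist_to_set_def by (intro INF_lower2[of y] ennreal_leI)
qed

section \<open>Continuous interval-valued maps\<close>

definition continuous_interval_map :: "(real \<Rightarrow> real set) \<Rightarrow> bool" where
  "continuous_interval_map F \<longleftrightarrow>
     continuous_on UNIV (lower_map F) \<and> continuous_on UNIV (upper_map F) \<and>
     (\<forall>x. lower_map F x \<le> upper_map F x \<and> F x = {lower_map F x..upper_map F x})"

lemma continuous_interval_mapI:
  assumes "\<And>x. F x \<in> nonempty_compacts" "\<And>x. is_interval (F x)"
    and "continuous_on UNIV (lower_map F)" "continuous_on UNIV (upper_map F)"
  shows "continuous_interval_map F"
proof -
  have "lower_map F x \<le> upper_map F x \<and> F x = {lower_map F x..upper_map F x}" for x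
  proof -
    have "connected (F x) \<and> compact (F x)" "F x \<noteq> {}"
      using assms(1)[of x] assms(2)[of x] by (auto simp: nonempty_compacts_def is_interval_connected_1)
    then obtain a b where "F x = {a..b}" "a \<le> b"
      unfolding connected_compact_interval_1 by fastforce
    then show ?thesis
      by (simp add: lower_map_def upper_map_def)
  qed
  then show ?thesis
    using assms(3,4) by (simp add: continuous_interval_map_def)
qed

text \<open>Parametrising each value \<open>F x\<close> affinely by \<open>[0, 1]\<close> exhibits the image of \<open>K\<close> as a
  continuous image of \<open>K \<times> [0, 1]\<close>.\<close>

lemma compact_set_image:
  assumes F: "continuous_interval_map F" and K: "compact K"
  shows "compact (set_image F K)"
proof -
  let ?l = "lower_map F" and ?u = "upper_map F"
  let ?h = "\<lambda>(x, t). ?l x + t * (?u x - ?l x)"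
  have l: "continuous_on S (\<lambda>p. ?l (fst p))" and u: "continuous_on S (\<lambda>p. ?u (fst p))"
    for S :: "(real \<times> real) set"
    using F by (auto simp: continuous_interval_map_def intro!: continuous_on_compose2[OF _ continuous_on_fst])
  have "set_image F K = ?h ` (K \<times> {0..1})"
  proof (intro set_eqI iffI)
    fix z assume "z \<in> set_image F K"
    then obtain x where x: "x \<in> K" "?l x \<le> z" "z \<le> ?u x"
      using F unfolding continuous_interval_map_def set_image_def by fastforce
    define t where "t = (if ?l x = ?u x then 0 else (z - ?l x) / (?u x - ?l x))"
    have "0 \<le> t" "t \<le> 1" "z = ?h (x, t)"
      using x(2,3) by (auto simp: t_def)
    then show "z \<in> ?h ` (K \<times> {0..1})"
      using x(1) by (intro image_eqI[of _ _ "(x, t)"]) auto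
  next
    fix z assume "z \<in> ?h ` (K \<times> {0..1})"
    then obtain x t where x: "x \<in> K" "0 \<le> t" "t \<le> 1" "z = ?l x + t * (?u x - ?l x)"
      by auto
    have lu: "?l x \<le> ?u x" "F x = {?l x..?u x}"
      using F by (auto simp: continuous_interval_map_def)
    have "t * (?u x - ?l x) \<le> ?u x - ?l x"
      using mult_right_mono[of t 1 "?u x - ?l x"] lu(1) x(3) by simp
    then show "z \<in> set_image F K"
      using x lu unfolding set_image_def by auto
  qed
  moreover have "compact (?h ` (K \<times> {0..1}))"
    using K by (intro compact_continuous_image compact_Times)
      (auto simp: case_prod_unfold intro!: continuous_intros l u)
  ultimately show ?thesis by simp
qed

lemma continuous_interval_map_lower_semicontinuous:
  assumes F: "continuous_interval_map F" and z: "z \<in> F x" and "\<epsilon> > 0"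
  shows "\<exists>\<delta>>0. \<forall>x'. \<bar>x - x'\<bar> < \<delta> \<longrightarrow> (\<exists>z'\<in>F x'. \<bar>z - z'\<bar> < \<epsilon>)"
proof -
  let ?l = "lower_map F" and ?u = "upper_map F"
  have "isCont ?l x" "isCont ?u x"
    using F by (auto simp: continuous_interval_map_def continuous_on_eq_continuous_at)
  then obtain d1 d2 where
    d1: "d1 > 0" "\<And>x'. dist x' x < d1 \<Longrightarrow> dist (?l x') (?l x) < \<epsilon>" and
    d2: "d2 > 0" "\<And>x'. dist x' x < d2 \<Longrightarrow> dist (?u x') (?u x) < \<epsilon>"
    using \<open>\<epsilon> > 0\<close> unfolding continuous_at_eps_delta dist_norm by metis
  have "\<exists>z'\<in>F x'. \<bar>z - z'\<bar> < \<epsilon>" if "\<bar>x - x'\<bar> < min d1 d2" for x'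
  proof -
    have "\<bar>?l x' - ?l x\<bar> < \<epsilon>" "\<bar>?u x' - ?u x\<bar> < \<epsilon>"
      using that d1(2)[of x'] d2(2)[of x'] by (auto simp: dist_real_def abs_minus_commute)
    moreover have "?l x \<le> z" "z \<le> ?u x" "?l x' \<le> ?u x'" "F x' = {?l x'..?u x'}"
      using F z unfolding continuous_interval_map_def by auto
    ultimately show ?thesis
      \<comment> \<open>the point of \<open>F x'\<close> nearest to \<open>z\<close>\<close>
      by (intro bexI[of _ "max (?l x') (min z (?u x'))"]) auto
  qed
  then show ?thesis
    using d1(1) d2(1) by (intro exI[of _ "min d1 d2"]) auto
qed

section \<open>Minimal invariant sets\<close>

text \<open>A minimal nonempty compact forward invariant set \<open>M\<close>, obtained by Zorn's lemma, satisfies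
  \<open>F(M) = M\<close> since \<open>F(M)\<close> is again compact and forward invariant.\<close>

lemma exists_minimal_invariant:
  assumes F: "continuous_interval_map F"
    and K: "compact K" "K \<noteq> {}" "set_image F K \<subseteq> K"
  shows "\<exists>E\<subseteq>K. minimal_invariant F E"
proof -
  define \<A> where "\<A> = {L. compact L \<and> L \<noteq> {} \<and> L \<subseteq> K \<and> set_image F L \<subseteq> L}"
  have "\<exists>M\<in>\<A>. \<forall>L\<in>\<A>. L \<subseteq> M \<longrightarrow> L = M"
  proof (rule predicate_Zorn)
    show "partial_order_on \<A> (relation_of (\<lambda>M L. L \<subseteq> M) \<A>)"
      by (rule partial_order_on_relation_ofI) auto
    fix C assume C: "C \<in> Chains (relation_of (\<lambda>M L. L \<subseteq> M) \<A>)"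
    have CA: "C \<subseteq> \<A>" and total: "\<And>S T. S \<in> C \<and> T \<in> C \<Longrightarrow> S \<subseteq> T \<or> T \<subseteq> S"
      using C by (auto simp: Chains_def relation_of_def)
    show "\<exists>u\<in>\<A>. \<forall>a\<in>C. u \<subseteq> a"
    proof (cases "C = {}")
      case True
      then show ?thesis using K by (auto simp: \<A>_def)
    next
      case False
      have "\<Inter>C \<noteq> {}"
        using CA total by (intro compact_chain) (auto simp: \<A>_def)
      moreover have "compact (\<Inter>C)"
        using CA False by (intro compact_Inter) (auto simp: \<A>_def)
      moreover have "\<Inter>C \<subseteq> K"
        using CA False by (auto simp: \<A>_def)
      moreover have "set_image F (\<Inter>C) \<subseteq> S" if "S \<in> C" for S
      proof -
        have "set_image F (\<Inter>C) \<subseteq> set_image F S"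
          using that by (auto simp: set_image_def)
        then show ?thesis
          using that CA by (auto simp: \<A>_def)
      qed
      ultimately have "\<Inter>C \<in> \<A>"
        unfolding \<A>_def by blast
      then show ?thesis by blast
    qed
  qed
  then obtain M where M: "M \<in> \<A>" and least: "\<And>L. L \<in> \<A> \<Longrightarrow> L \<subseteq> M \<Longrightarrow> L = M"
    by blast
  have sub: "set_image F M \<subseteq> M" and cM: "compact M" "M \<noteq> {}" "M \<subseteq> K"
    using M by (auto simp: \<A>_def)
  have "F x \<noteq> {}" for x
    using F unfolding continuous_interval_map_def by (metis atLeastatMost_empty_iff)
  then have "set_image F M \<noteq> {}"
    using cM(2) by (auto simp: set_image_def)
  moreover have "set_image F (set_image F M) \<subseteq> set_image F M"
    using sub by (auto simp: set_image_def)
  ultimately have "set_image F M \<in> \<A>"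
    using sub cM compact_set_image[OF F cM(1)] by (auto simp: \<A>_def)
  then have "set_image F M = M"
    using least sub by blast
  moreover have "set_image F E' \<noteq> E'" if "E' \<in> nonempty_compacts" "E' \<subset> M" for E'
    using that least[of E'] cM by (auto simp: \<A>_def nonempty_compacts_def)
  ultimately have "minimal_invariant F M"
    using cM by (auto simp: minimal_invariant_def nonempty_compacts_def)
  then show ?thesis
    using cM by blast
qed

text \<open>Minimality among invariant sets implies minimality among forward invariant ones, because every
  forward invariant compact set contains an invariant one.\<close>

lemma minimal_invariant_forward_invariant_eq:
  assumes "continuous_interval_map F" and E: "minimal_invariant F E"
    and "compact K" "K \<noteq> {}" "set_image F K \<subseteq> K" "K \<subseteq> E"
  shows "K = E"
proof -
  obtain E' where "E' \<subseteq> K" "minimal_invariant F E'"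
    using exists_minimal_invariant[OF assms(1,3-5)] by blast
  then have "E' \<in> nonempty_compacts" "set_image F E' = E'" "E' \<subseteq> E"
    using \<open>K \<subseteq> E\<close> by (auto simp: minimal_invariant_def)
  then have "E' = E"
    using E by (auto simp: minimal_invariant_def)
  then show ?thesis
    using \<open>E' \<subseteq> K\<close> \<open>K \<subseteq> E\<close> by blast
qed

text \<open>Inside a minimal invariant set \<open>E\<close>, the part lying in a forward invariant set is itself
  forward invariant.\<close>

lemma minimal_invariant_trapped:
  assumes "continuous_interval_map F" and E: "minimal_invariant F E"
    and U: "closed U" "set_image F U \<subseteq> U" and "E \<inter> U \<noteq> {}"
  shows "E \<subseteq> U"
proof -
  have "compact E" "set_image F E = E"
    using E by (auto simp: minimal_invariant_def nonempty_compacts_def)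
  moreover have "set_image F (E \<inter> U) \<subseteq> set_image F E \<inter> set_image F U"
    by (auto simp: set_image_def)
  ultimately have "E \<inter> U = E"
    using assms by (intro minimal_invariant_forward_invariant_eq[OF assms(1,2)]) auto
  then show ?thesis by blast
qed

section \<open>Lower semicontinuity at a minimal invariant set\<close>

text \<open>Sets that are forward invariant for ever closer approximations \<open>G\<close> of \<open>F\<close> accumulate on a set
  that is forward invariant for \<open>F\<close>, because the values of \<open>F\<close> vary lower semicontinuously. Minimality
  of \<open>E\<close> leaves no room for this limit set to omit a point \<open>y\<close>.\<close>

lemma forward_invariant_hits_point:
  assumes F: "continuous_interval_map F" and E: "minimal_invariant F E"
    and y: "y \<in> E" and \<epsilon>: "\<epsilon> > 0"
  shows "\<exists>\<eta>>0. \<forall>G K. (\<forall>x. hausdorff_dist (G x) (F x) < ennreal \<eta>) \<longrightarrow> K \<noteq> {} \<longrightarrow>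
           set_image G K \<subseteq> K \<longrightarrow> (\<forall>x\<in>K. \<exists>e\<in>E. \<bar>x - e\<bar> < \<eta>) \<longrightarrow> (\<exists>x\<in>K. \<bar>y - x\<bar> < \<epsilon>)"
proof (rule ccontr)
  \<comment> \<open>\<open>P \<eta>\<close> collects the points of all counterexamples \<open>K\<close> at closeness \<open>\<eta>\<close>, and \<open>L\<close> is their
    limit set as \<open>\<eta>\<close> tends to 0. It is forward invariant for \<open>F\<close> but omits \<open>y\<close>.\<close>
  define bad where "bad \<eta> G K \<longleftrightarrow> (\<forall>x. hausdorff_dist (G x) (F x) < ennreal \<eta>) \<and> K \<noteq> {} \<and>
    set_image G K \<subseteq> K \<and> (\<forall>x\<in>K. \<exists>e\<in>E. \<bar>x - e\<bar> < \<eta>) \<and> \<not> (\<exists>x\<in>K. \<bar>y - x\<bar> < \<epsilon>)"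
    for \<eta> and G :: "real \<Rightarrow> real set" and K
  define P where "P \<eta> = \<Union>{K. \<exists>G. bad \<eta> G K}" for \<eta>
  define L where "L = (\<Inter>\<eta>\<in>{0<..}. closure (P \<eta>))"
  assume neg: "\<not> ?thesis"
  have ex: "\<exists>G K. bad \<eta> G K" if "\<eta> > 0" for \<eta>
  proof (rule ccontr)
    assume none: "\<not> ?thesis"
    have "\<exists>x\<in>K. \<bar>y - x\<bar> < \<epsilon>"
      if "\<forall>x. hausdorff_dist (G x) (F x) < ennreal \<eta>" "K \<noteq> {}" "set_image G K \<subseteq> K"
        "\<forall>x\<in>K. \<exists>e\<in>E. \<bar>x - e\<bar> < \<eta>" for G K
    proof -
      have "\<not> bad \<eta> G K"
        using none by blast
      then show ?thesis
        using that by (simp add: bad_def)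
    qed
    with neg \<open>\<eta> > 0\<close> show False by metis
  qed
  have ne: "P \<eta> \<noteq> {}" if "\<eta> > 0" for \<eta>
    using ex[OF that] unfolding P_def bad_def by blast
  have bad_mono: "bad \<eta>' G K" if "bad \<eta> G K" "\<eta> \<le> \<eta>'" for \<eta> \<eta>' G K
    using that ennreal_leI[OF that(2)] unfolding bad_def by (meson order_less_le_trans)
  have mono: "P \<eta> \<subseteq> P \<eta>'" if "\<eta> \<le> \<eta>'" for \<eta> \<eta>'
    using bad_mono that unfolding P_def by blast
  have near: "\<exists>e\<in>E. \<bar>x - e\<bar> < \<eta>" if "x \<in> P \<eta>" for x \<eta>
    using that unfolding P_def bad_def by blast
  have cE: "compact E" "E \<noteq> {}"
    using E by (auto simp: minimal_invariant_def nonempty_compacts_def)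
  have cl_near: "\<exists>e\<in>E. \<bar>x - e\<bar> < 2 * \<eta>" if x: "x \<in> closure (P \<eta>)" "\<eta> > 0" for x \<eta>
  proof -
    obtain x' where x': "x' \<in> P \<eta>" "\<bar>x' - x\<bar> < \<eta>"
      using x by (metis closure_approachable dist_real_def)
    obtain e where e: "e \<in> E" "\<bar>x' - e\<bar> < \<eta>"
      using near[OF x'(1)] by blast
    have "\<bar>x - e\<bar> < 2 * \<eta>"
      using x'(2) e(2) by linarith
    with e(1) show ?thesis by blast
  qed
  have cP: "compact (closure (P \<eta>))" if "\<eta> > 0" for \<eta>
  proof -
    obtain B where B: "\<And>e. e \<in> E \<Longrightarrow> \<bar>e\<bar> \<le> B"
      using compact_imp_bounded[OF cE(1)] unfolding bounded_iff real_norm_def by blast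
    have "\<bar>x\<bar> \<le> B + \<eta>" if "x \<in> P \<eta>" for x
      using near[OF that] B by fastforce
    then show ?thesis
      unfolding compact_closure bounded_iff real_norm_def by blast
  qed
  have "L \<noteq> {}"
    unfolding L_def
  proof (rule compact_chain)
    show "compact S" if "S \<in> (\<lambda>\<eta>. closure (P \<eta>)) ` {0<..}" for S
      using that cP by auto
    show "{} \<notin> (\<lambda>\<eta>. closure (P \<eta>)) ` {0<..}"
    proof
      assume "{} \<in> (\<lambda>\<eta>. closure (P \<eta>)) ` {0<..}"
      then obtain \<eta> where "\<eta> > 0" "{} = closure (P \<eta>)"
        by blast
      then show False
        using ne[of \<eta>] closure_subset[of "P \<eta>"] by blast
    qed
    show "S \<subseteq> T \<or> T \<subseteq> S"
      if ST: "S \<in> (\<lambda>\<eta>. closure (P \<eta>)) ` {0<..} \<and> T \<in> (\<lambda>\<eta>. closure (P \<eta>)) ` {0<..}" for S T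
    proof -
      obtain a b where "S = closure (P a)" "T = closure (P b)"
        using ST by blast
      then show ?thesis
        using mono[of a b] mono[of b a] closure_mono linorder_linear[of a b] by metis
    qed
  qed
  moreover have LE: "L \<subseteq> E"
  proof
    fix x assume x: "x \<in> L"
    have "\<exists>e\<in>E. dist e x < \<delta>" if "\<delta> > 0" for \<delta>
      using cl_near[of x "\<delta> / 2"] that x by (force simp: L_def dist_real_def abs_minus_commute)
    then have "x \<in> closure E"
      by (simp add: closure_approachable)
    then show "x \<in> E"
      using cE(1) compact_imp_closed closure_closed by blast
  qed
  moreover have "compact L"
  proof -
    have "closed L" by (auto simp: L_def)
    then show ?thesis
      using LE cE(1) by (metis compact_Int_closed inf.absorb2)
  qed
  moreover have "set_image F L \<subseteq> L"
  proof
    fix z assume "z \<in> set_image F L"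
    then obtain x where x: "x \<in> L" "z \<in> F x"
      by (auto simp: set_image_def)
    have "\<exists>w\<in>P \<eta>. dist w z < \<delta>" if "\<eta> > 0" "\<delta> > 0" for \<eta> \<delta>
    proof -
      obtain r where r: "r > 0" "\<And>x'. \<bar>x - x'\<bar> < r \<Longrightarrow> \<exists>z'\<in>F x'. \<bar>z - z'\<bar> < \<delta> / 2"
        using continuous_interval_map_lower_semicontinuous[OF F x(2), of "\<delta> / 2"] \<open>\<delta> > 0\<close> by auto
      define \<eta>' where "\<eta>' = min \<eta> (\<delta> / 2)"
      have "\<eta>' > 0" using that by (simp add: \<eta>'_def)
      then have "x \<in> closure (P \<eta>')" using x(1) by (auto simp: L_def)
      then obtain x' where x': "x' \<in> P \<eta>'" "\<bar>x' - x\<bar> < r"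
        using r(1) by (metis closure_approachable dist_real_def)
      obtain G K where GK: "bad \<eta>' G K" "x' \<in> K"
        using x'(1) unfolding P_def by blast
      obtain z' where z': "z' \<in> F x'" "\<bar>z - z'\<bar> < \<delta> / 2"
        using r(2)[of x'] x'(2) by (auto simp: abs_minus_commute)
      have "hausdorff_dist (F x') (G x') < ennreal \<eta>'"
        using GK(1) by (simp add: bad_def hausdorff_dist_commute)
      then obtain w where w: "w \<in> G x'" "\<bar>z' - w\<bar> < \<eta>'"
        using hausdorff_dist_less_near z'(1) by blast
      have "w \<in> K"
        using GK w(1) unfolding bad_def set_image_def by blast
      then have "w \<in> P \<eta>'"
        using GK(1) unfolding P_def by blast
      then have "w \<in> P \<eta>"
        using mono[of \<eta>' \<eta>] by (auto simp: \<eta>'_def)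
      moreover have "dist w z < \<delta>"
        using z'(2) w(2) unfolding \<eta>'_def dist_real_def by linarith
      ultimately show ?thesis by blast
    qed
    then show "z \<in> L"
      by (auto simp: L_def closure_approachable)
  qed
  ultimately have "L = E"
    using minimal_invariant_forward_invariant_eq[OF F E] by blast
  then have "y \<in> closure (P 1)"
    using y by (auto simp: L_def)
  then obtain x where x: "x \<in> P 1" "\<bar>x - y\<bar> < \<epsilon>"
    using \<epsilon> by (metis closure_approachable dist_real_def)
  then show False
    unfolding P_def bad_def by (auto simp: abs_minus_commute)
qed

text \<open>The closeness \<open>\<eta>\<close> can be chosen uniformly over \<open>E\<close>, since by compactness only finitely many
  points of \<open>E\<close> have to be approached.\<close>

lemma forward_invariant_hits_minimal:
  assumes F: "continuous_interval_map F" and E: "minimal_invariant F E" and \<epsilon>: "\<epsilon> > 0"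
  shows "\<exists>\<eta>>0. \<forall>G K. (\<forall>x. hausdorff_dist (G x) (F x) < ennreal \<eta>) \<longrightarrow> K \<noteq> {} \<longrightarrow>
           set_image G K \<subseteq> K \<longrightarrow> (\<forall>x\<in>K. \<exists>e\<in>E. \<bar>x - e\<bar> < \<eta>) \<longrightarrow> (\<forall>y\<in>E. \<exists>x\<in>K. \<bar>y - x\<bar> < \<epsilon>)"
proof -
  have cE: "compact E" "E \<noteq> {}"
    using E by (auto simp: minimal_invariant_def nonempty_compacts_def)
  obtain C where C: "finite C" "C \<subseteq> E" "E \<subseteq> (\<Union>p\<in>C. ball p (\<epsilon> / 2))"
    using compact_imp_seq_compact[OF cE(1)] seq_compact_imp_totally_bounded \<epsilon> half_gt_zero by metis
  have "C \<noteq> {}" using C(3) cE(2) by auto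
  define good where "good p \<eta> \<longleftrightarrow> \<eta> > 0 \<and> (\<forall>G K. (\<forall>x. hausdorff_dist (G x) (F x) < ennreal \<eta>) \<longrightarrow>
    K \<noteq> {} \<longrightarrow> set_image G K \<subseteq> K \<longrightarrow> (\<forall>x\<in>K. \<exists>e\<in>E. \<bar>x - e\<bar> < \<eta>) \<longrightarrow>
    (\<exists>x\<in>K. \<bar>p - x\<bar> < \<epsilon> / 2))" for p \<eta>
  have "\<exists>\<eta>. good p \<eta>" if "p \<in> C" for p
    using forward_invariant_hits_point[OF F E, of p "\<epsilon> / 2"] that C(2) \<epsilon> unfolding good_def by auto
  then obtain h where h: "\<And>p. p \<in> C \<Longrightarrow> good p (h p)"
    by metis
  define \<eta> where "\<eta> = Min (h ` C)"
  have "\<eta> > 0"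
    using C(1) \<open>C \<noteq> {}\<close> h unfolding \<eta>_def good_def by (subst Min_gr_iff) auto
  have le: "\<eta> \<le> h p" if "p \<in> C" for p
    using that C(1) unfolding \<eta>_def by simp
  have "\<exists>x\<in>K. \<bar>y - x\<bar> < \<epsilon>"
    if G: "\<forall>x. hausdorff_dist (G x) (F x) < ennreal \<eta>" and K: "K \<noteq> {}" "set_image G K \<subseteq> K"
      "\<forall>x\<in>K. \<exists>e\<in>E. \<bar>x - e\<bar> < \<eta>" and y: "y \<in> E" for G K y
  proof -
    obtain p where p: "p \<in> C" "\<bar>p - y\<bar> < \<epsilon> / 2"
      using y C(3) by (auto simp: dist_real_def)
    have "\<forall>x. hausdorff_dist (G x) (F x) < ennreal (h p)"
      using G ennreal_leI[OF le[OF p(1)]] by (meson order_less_le_trans)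
    moreover have "\<forall>x\<in>K. \<exists>e\<in>E. \<bar>x - e\<bar> < h p"
      using K(3) le[OF p(1)] by (meson order_less_le_trans)
    ultimately obtain x where x: "x \<in> K" "\<bar>p - x\<bar> < \<epsilon> / 2"
      using h[OF p(1)] K unfolding good_def by blast
    then have "\<bar>y - x\<bar> < \<epsilon>"
      using p(2) by linarith
    with x(1) show ?thesis by blast
  qed
  then show ?thesis
    using \<open>\<eta> > 0\<close> by blast
qed

section \<open>Contraction towards the endpoints\<close>

lemma has_field_derivative_local_lipschitz:
  fixes f :: "real \<Rightarrow> real"
  assumes "(f has_field_derivative D) (at a)" "\<bar>D\<bar> < c"
  shows "\<exists>d>0. \<forall>x. \<bar>x - a\<bar> \<le> d \<longrightarrow> \<bar>f x - f a\<bar> \<le> c * \<bar>x - a\<bar>"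
proof -
  have "((\<lambda>x. (f x - f a) / (x - a)) \<longlongrightarrow> D) (at a)"
    using assms(1) by (simp add: has_field_derivative_iff)
  then have "((\<lambda>x. \<bar>(f x - f a) / (x - a)\<bar>) \<longlongrightarrow> \<bar>D\<bar>) (at a)"
    by (rule tendsto_rabs)
  then have "\<forall>\<^sub>F x in at a. \<bar>(f x - f a) / (x - a)\<bar> < c"
    using assms(2) by (rule order_tendstoD)
  then obtain d where d: "d > 0" "\<And>x. x \<noteq> a \<Longrightarrow> dist x a < d \<Longrightarrow> \<bar>(f x - f a) / (x - a)\<bar> < c"
    unfolding eventually_at by blast
  have "\<bar>f x - f a\<bar> \<le> c * \<bar>x - a\<bar>" if "\<bar>x - a\<bar> \<le> d / 2" for x
  proof (cases "x = a")
    case False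
    then have "\<bar>f x - f a\<bar> / \<bar>x - a\<bar> < c"
      using d(2)[of x] that d(1) by (simp add: dist_real_def)
    then show ?thesis
      using False by (simp add: divide_simps split: if_splits)
  qed auto
  then show ?thesis
    using d(1) by (intro exI[of _ "d / 2"]) auto
qed

text \<open>A point outside \<open>[e\<^sub>1, e\<^sub>2]\<close> is compared with the nearest endpoint, where the extremal maps take
  values in \<open>[e\<^sub>1, e\<^sub>2]\<close> and contract with the common factor \<open>c\<close>.\<close>

lemma endpoint_contraction:
  fixes l u :: "real \<Rightarrow> real"
  assumes "e\<^sub>1 \<le> e\<^sub>2"
    and l: "\<And>x. x \<in> {e\<^sub>1..e\<^sub>2} \<Longrightarrow> e\<^sub>1 \<le> l x" and u: "\<And>x. x \<in> {e\<^sub>1..e\<^sub>2} \<Longrightarrow> u x \<le> e\<^sub>2"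
    and diff: "\<And>x. l field_differentiable at x" "\<And>x. u field_differentiable at x"
    and deriv: "\<bar>deriv l e\<^sub>1\<bar> < 1" "\<bar>deriv u e\<^sub>1\<bar> < 1" "\<bar>deriv l e\<^sub>2\<bar> < 1" "\<bar>deriv u e\<^sub>2\<bar> < 1"
  shows "\<exists>c d. 0 < c \<and> c < 1 \<and> 0 < d \<and>
    (\<forall>t x. 0 \<le> t \<longrightarrow> t \<le> d \<longrightarrow> x \<in> {e\<^sub>1 - t..e\<^sub>2 + t} \<longrightarrow> e\<^sub>1 - c * t \<le> l x \<and> u x \<le> e\<^sub>2 + c * t)"
proof -
  define m where "m = max (max \<bar>deriv l e\<^sub>1\<bar> \<bar>deriv u e\<^sub>1\<bar>) (max \<bar>deriv l e\<^sub>2\<bar> \<bar>deriv u e\<^sub>2\<bar>)"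
  have "m < 1" using deriv unfolding m_def by (simp only: max_less_iff_conj simp_thms)
  then obtain c where c: "m < c" "c < 1" using dense by blast
  then have small: "\<bar>deriv l e\<^sub>1\<bar> < c" "\<bar>deriv u e\<^sub>1\<bar> < c" "\<bar>deriv l e\<^sub>2\<bar> < c" "\<bar>deriv u e\<^sub>2\<bar> < c"
    unfolding m_def by (simp_all only: max_less_iff_conj)
  then have "0 < c" by linarith
  have lip: "\<exists>d>0. \<forall>x. \<bar>x - a\<bar> \<le> d \<longrightarrow> \<bar>f x - f a\<bar> \<le> c * \<bar>x - a\<bar>"
    if "f field_differentiable at a" "\<bar>deriv f a\<bar> < c" for f a
    using has_field_derivative_local_lipschitz that field_differentiable_derivI by blast
  obtain d1 where d1: "d1 > 0" "\<And>x. \<bar>x - e\<^sub>1\<bar> \<le> d1 \<Longrightarrow> \<bar>l x - l e\<^sub>1\<bar> \<le> c * \<bar>x - e\<^sub>1\<bar>"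
    using lip[OF diff(1) small(1)] by blast
  obtain d2 where d2: "d2 > 0" "\<And>x. \<bar>x - e\<^sub>1\<bar> \<le> d2 \<Longrightarrow> \<bar>u x - u e\<^sub>1\<bar> \<le> c * \<bar>x - e\<^sub>1\<bar>"
    using lip[OF diff(2) small(2)] by blast
  obtain d3 where d3: "d3 > 0" "\<And>x. \<bar>x - e\<^sub>2\<bar> \<le> d3 \<Longrightarrow> \<bar>l x - l e\<^sub>2\<bar> \<le> c * \<bar>x - e\<^sub>2\<bar>"
    using lip[OF diff(1) small(3)] by blast
  obtain d4 where d4: "d4 > 0" "\<And>x. \<bar>x - e\<^sub>2\<bar> \<le> d4 \<Longrightarrow> \<bar>u x - u e\<^sub>2\<bar> \<le> c * \<bar>x - e\<^sub>2\<bar>"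
    using lip[OF diff(2) small(4)] by blast
  define d where "d = Min {d1, d2, d3, d4}"
  have d: "d > 0" "d \<le> d1" "d \<le> d2" "d \<le> d3" "d \<le> d4"
    using d1(1) d2(1) d3(1) d4(1) by (auto simp: d_def)
  have ends: "e\<^sub>1 \<le> l e\<^sub>1" "e\<^sub>1 \<le> l e\<^sub>2" "u e\<^sub>1 \<le> e\<^sub>2" "u e\<^sub>2 \<le> e\<^sub>2"
    using l u \<open>e\<^sub>1 \<le> e\<^sub>2\<close> by auto
  have "e\<^sub>1 - c * t \<le> l x \<and> u x \<le> e\<^sub>2 + c * t"
    if t: "0 \<le> t" "t \<le> d" and x: "x \<in> {e\<^sub>1 - t..e\<^sub>2 + t}" for t x
  proof -
    consider "x < e\<^sub>1" | "x \<in> {e\<^sub>1..e\<^sub>2}" | "x > e\<^sub>2" by fastforce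
    then show ?thesis
    proof cases
      case 1
      then have *: "\<bar>x - e\<^sub>1\<bar> \<le> t" using x by auto
      then have "c * \<bar>x - e\<^sub>1\<bar> \<le> c * t" using \<open>0 < c\<close> by simp
      moreover have "\<bar>l x - l e\<^sub>1\<bar> \<le> c * \<bar>x - e\<^sub>1\<bar>" "\<bar>u x - u e\<^sub>1\<bar> \<le> c * \<bar>x - e\<^sub>1\<bar>"
        using * t d by (auto intro!: d1(2) d2(2))
      ultimately show ?thesis using ends by linarith
    next
      case 2
      have "0 \<le> c * t" using \<open>0 < c\<close> t by simp
      then show ?thesis using l[OF 2] u[OF 2] by linarith
    next
      case 3
      then have *: "\<bar>x - e\<^sub>2\<bar> \<le> t" using x by auto
      then have "c * \<bar>x - e\<^sub>2\<bar> \<le> c * t" using \<open>0 < c\<close> by simp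
      moreover have "\<bar>l x - l e\<^sub>2\<bar> \<le> c * \<bar>x - e\<^sub>2\<bar>" "\<bar>u x - u e\<^sub>2\<bar> \<le> c * \<bar>x - e\<^sub>2\<bar>"
        using * t d by (auto intro!: d3(2) d4(2))
      ultimately show ?thesis using ends by linarith
    qed
  qed
  then show ?thesis
    using \<open>0 < c\<close> c(2) d(1) by blast
qed

text \<open>If \<open>K\<close> protrudes from \<open>[e\<^sub>1, e\<^sub>2]\<close> by exactly \<open>t\<close>, then \<open>K = G(K)\<close> protrudes by at most
  \<open>c t + \<eta>\<close>, whence \<open>t \<le> c t + \<eta>\<close>.\<close>

lemma invariant_near_contracting:
  assumes c: "0 < c" "c < 1" and "0 \<le> \<eta>"
    and contr: "\<And>t x. 0 \<le> t \<Longrightarrow> t \<le> d \<Longrightarrow> x \<in> {e\<^sub>1 - t..e\<^sub>2 + t} \<Longrightarrow>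
      G x \<subseteq> {e\<^sub>1 - c * t - \<eta>..e\<^sub>2 + c * t + \<eta>}"
    and K: "compact K" "set_image G K = K" "K \<subseteq> {e\<^sub>1 - d..e\<^sub>2 + d}" and "0 \<le> d"
  shows "K \<subseteq> {e\<^sub>1 - \<eta> / (1 - c)..e\<^sub>2 + \<eta> / (1 - c)}"
proof (cases "K = {}")
  case False
  obtain a where a: "a \<in> K" "\<And>x. x \<in> K \<Longrightarrow> a \<le> x"
    using compact_attains_inf[OF K(1) False] by blast
  obtain b where b: "b \<in> K" "\<And>x. x \<in> K \<Longrightarrow> x \<le> b"
    using compact_attains_sup[OF K(1) False] by blast
  define t where "t = max 0 (max (e\<^sub>1 - a) (b - e\<^sub>2))"
  have t: "0 \<le> t" "t \<le> d"
    using K(3) a(1) b(1) \<open>0 \<le> d\<close> by (auto simp: t_def)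
  have Kt: "K \<subseteq> {e\<^sub>1 - t..e\<^sub>2 + t}"
    using a(2) b(2) by (fastforce simp: t_def)
  have "K \<subseteq> {e\<^sub>1 - c * t - \<eta>..e\<^sub>2 + c * t + \<eta>}"
    using contr[OF t] Kt K(2) unfolding set_image_def by blast
  then have "e\<^sub>1 - c * t - \<eta> \<le> a" "b \<le> e\<^sub>2 + c * t + \<eta>"
    using a(1) b(1) by auto
  moreover have "0 \<le> c * t" using c t by simp
  ultimately have "t \<le> c * t + \<eta>"
    using \<open>0 \<le> \<eta>\<close> unfolding t_def by (intro max.boundedI) auto
  then have "t * (1 - c) \<le> \<eta>" by (simp add: algebra_simps)
  then have "t \<le> \<eta> / (1 - c)" using c by (simp add: pos_le_divide_eq)
  then show ?thesis
    using Kt by auto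
qed simp

section \<open>Persistence without bifurcation\<close>

text \<open>Here \<open>G\<close> stands for a member of the family whose parameter is close to \<open>\<alpha>\<^sub>0\<close>. The constants
  \<open>c\<close> and \<open>d\<close> are those of \<open>endpoint_contraction\<close>; the neighbourhood \<open>U\<close> depends on \<open>d\<close> but not on
  \<open>\<epsilon>\<close>, as continuity requires.\<close>

lemma minimal_union_near:
  assumes F: "continuous_interval_map F" and E: "minimal_invariant F {e\<^sub>1..e\<^sub>2}"
    and c: "0 < c" "c < 1" and d: "0 < d"
    and contr: "\<And>t x. 0 \<le> t \<Longrightarrow> t \<le> d \<Longrightarrow> x \<in> {e\<^sub>1 - t..e\<^sub>2 + t} \<Longrightarrow>
      e\<^sub>1 - c * t \<le> lower_map F x \<and> upper_map F x \<le> e\<^sub>2 + c * t"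
    and \<epsilon>: "0 < \<epsilon>"
  defines "U \<equiv> {e\<^sub>1 - d..e\<^sub>2 + d}"
  shows "\<exists>\<eta>>0. \<forall>G. continuous_interval_map G \<longrightarrow> (\<forall>x. hausdorff_dist (G x) (F x) < ennreal \<eta>) \<longrightarrow>
           hausdorff_dist (U \<inter> minimal_union G) (U \<inter> minimal_union F) < ennreal \<epsilon>"
proof -
  have e: "e\<^sub>1 \<le> e\<^sub>2"
    using E by (auto simp: minimal_invariant_def nonempty_compacts_def)
  obtain \<eta>\<^sub>1 where \<eta>\<^sub>1: "\<eta>\<^sub>1 > 0" and hits: "\<And>G K y. (\<forall>x. hausdorff_dist (G x) (F x) < ennreal \<eta>\<^sub>1) \<Longrightarrow>
      K \<noteq> {} \<Longrightarrow> set_image G K \<subseteq> K \<Longrightarrow> (\<forall>x\<in>K. \<exists>e\<in>{e\<^sub>1..e\<^sub>2}. \<bar>x - e\<bar> < \<eta>\<^sub>1) \<Longrightarrow> y \<in> {e\<^sub>1..e\<^sub>2} \<Longrightarrow>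
      \<exists>x\<in>K. \<bar>y - x\<bar> < \<epsilon> / 2"
    using forward_invariant_hits_minimal[OF F E, of "\<epsilon> / 2"] \<epsilon> by (metis half_gt_zero)
  define s where "s = Min {\<eta>\<^sub>1 / 2, \<epsilon> / 2, d}"
  have s: "0 < s" "s < \<eta>\<^sub>1" "s \<le> \<epsilon> / 2" "s \<le> d"
    using \<eta>\<^sub>1 \<epsilon> d by (auto simp: s_def)
  \<comment> \<open>so that \<open>\<eta> / (1 - c) = s\<close> and \<open>c d + \<eta> \<le> d\<close>\<close>
  define \<eta> where "\<eta> = s * (1 - c)"
  have \<eta>: "0 < \<eta>" "\<eta> / (1 - c) = s" "\<eta> \<le> d * (1 - c)" "\<eta> \<le> s"
    using s c mult_left_mono[of "1 - c" 1 s] by (auto simp: \<eta>_def)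
  have G_contr: "G x \<subseteq> {e\<^sub>1 - c * t - r..e\<^sub>2 + c * t + r}"
    if G: "\<forall>x. hausdorff_dist (G x) (F x) < ennreal r"
      and tx: "0 \<le> t" "t \<le> d" "x \<in> {e\<^sub>1 - t..e\<^sub>2 + t}" for G r t x
  proof
    fix z assume "z \<in> G x"
    then obtain w where w: "w \<in> F x" "\<bar>z - w\<bar> < r"
      using hausdorff_dist_less_near G by blast
    then have "lower_map F x \<le> w" "w \<le> upper_map F x"
      using F unfolding continuous_interval_map_def by auto
    then show "z \<in> {e\<^sub>1 - c * t - r..e\<^sub>2 + c * t + r}"
      using contr[OF tx] w(2) by auto
  qed
  have "closed U" "compact U" "U \<noteq> {}" using e d by (auto simp: U_def)
  have maps_U: "set_image G U \<subseteq> U"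
    if G: "\<forall>x. hausdorff_dist (G x) (F x) < ennreal r" and "r \<le> \<eta>" for G r
  proof -
    have "r \<le> d * (1 - c)" using \<open>r \<le> \<eta>\<close> \<eta>(3) by simp
    then have "e\<^sub>1 - d \<le> e\<^sub>1 - c * d - r" "e\<^sub>2 + c * d + r \<le> e\<^sub>2 + d"
      by (auto simp: algebra_simps)
    moreover have "\<And>x. x \<in> U \<Longrightarrow> G x \<subseteq> {e\<^sub>1 - c * d - r..e\<^sub>2 + c * d + r}"
      using G_contr[OF G] d by (simp add: U_def)
    ultimately show ?thesis
      unfolding set_image_def U_def by fastforce
  qed
  have trap: "E' \<subseteq> {e\<^sub>1 - r / (1 - c)..e\<^sub>2 + r / (1 - c)}"
    if G: "continuous_interval_map G" "\<forall>x. hausdorff_dist (G x) (F x) < ennreal r"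
      and r: "0 < r" "r \<le> \<eta>" and E': "minimal_invariant G E'" "E' \<inter> U \<noteq> {}" for G E' r
  proof -
    have "E' \<subseteq> U"
      using minimal_invariant_trapped maps_U[OF G(2) r(2)] G(1) E' \<open>closed U\<close> by blast
    then show ?thesis
      using E'(1) c d r G_contr[OF G(2)]
      by (intro invariant_near_contracting[where d = d and G = G])
        (auto simp: minimal_invariant_def nonempty_compacts_def U_def)
  qed
  \<comment> \<open>apply the same estimate to \<open>F\<close> itself with arbitrarily small \<open>r\<close>\<close>
  have MF: "U \<inter> minimal_union F = {e\<^sub>1..e\<^sub>2}"
  proof
    show "{e\<^sub>1..e\<^sub>2} \<subseteq> U \<inter> minimal_union F"
      using E d by (auto simp: U_def minimal_union_def)
    show "U \<inter> minimal_union F \<subseteq> {e\<^sub>1..e\<^sub>2}"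
    proof
      fix x assume "x \<in> U \<inter> minimal_union F"
      then obtain E' where E': "minimal_invariant F E'" "x \<in> E'" "E' \<inter> U \<noteq> {}"
        by (auto simp: minimal_union_def)
      have "e\<^sub>1 - q \<le> x \<and> x \<le> e\<^sub>2 + q" if "0 < q" for q
      proof -
        define r where "r = min q s * (1 - c)"
        have r: "0 < r" "r \<le> \<eta>" "r / (1 - c) \<le> q"
          using that s c by (auto simp: r_def \<eta>_def)
        have "hausdorff_dist (F y) (F y) < ennreal r" for y
        proof -
          have "hausdorff_semidist (F y) (F y) \<le> ennreal 0"
            by (rule hausdorff_semidist_le) auto
          then show ?thesis using r(1) by (simp add: hausdorff_dist_def)
        qed
        then have "x \<in> {e\<^sub>1 - r / (1 - c)..e\<^sub>2 + r / (1 - c)}"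
          using trap[OF F _ r(1,2) E'(1,3)] E'(2) by blast
        then show ?thesis using r(3) by auto
      qed
      then have "e\<^sub>1 \<le> x + q" "x \<le> e\<^sub>2 + q" if "0 < q" for q
        using that by (simp_all add: diff_le_eq)
      then show "x \<in> {e\<^sub>1..e\<^sub>2}"
        by (auto intro: field_le_epsilon)
    qed
  qed
  have "hausdorff_dist (U \<inter> minimal_union G) (U \<inter> minimal_union F) < ennreal \<epsilon>"
    if G: "continuous_interval_map G" "\<forall>x. hausdorff_dist (G x) (F x) < ennreal \<eta>" for G
  proof -
    have in_s: "E' \<subseteq> {e\<^sub>1 - s..e\<^sub>2 + s}" if "minimal_invariant G E'" "E' \<inter> U \<noteq> {}" for E'
      using trap[OF G \<eta>(1) order_refl that] \<eta>(2) by simp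
    have near: "\<exists>y\<in>{e\<^sub>1..e\<^sub>2}. \<bar>x - y\<bar> \<le> s" if "x \<in> {e\<^sub>1 - s..e\<^sub>2 + s}" for x
      using that e s(1) by (intro bexI[of _ "max e\<^sub>1 (min x e\<^sub>2)"]) auto
    have upper: "hausdorff_semidist (U \<inter> minimal_union G) {e\<^sub>1..e\<^sub>2} \<le> ennreal (\<epsilon> / 2)"
    proof (rule hausdorff_semidist_le)
      fix x assume "x \<in> U \<inter> minimal_union G"
      then have "x \<in> {e\<^sub>1 - s..e\<^sub>2 + s}"
        using in_s unfolding minimal_union_def by blast
      then show "\<exists>y\<in>{e\<^sub>1..e\<^sub>2}. \<bar>x - y\<bar> \<le> \<epsilon> / 2"
        using near s(3) order_trans by blast
    qed
    have "set_image G U \<subseteq> U"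
      using maps_U[OF G(2) order_refl] .
    then obtain E' where E': "E' \<subseteq> U" "minimal_invariant G E'"
      using exists_minimal_invariant[OF G(1)] \<open>compact U\<close> \<open>U \<noteq> {}\<close> by blast
    have E'_inv: "E' \<noteq> {}" "set_image G E' \<subseteq> E'"
      using E'(2) by (auto simp: minimal_invariant_def nonempty_compacts_def)
    have "E' \<subseteq> {e\<^sub>1 - s..e\<^sub>2 + s}"
      using in_s E' E'_inv(1) by blast
    then have close: "\<forall>x\<in>E'. \<exists>e\<in>{e\<^sub>1..e\<^sub>2}. \<bar>x - e\<bar> < \<eta>\<^sub>1"
      using near s(2) by (meson order_le_less_trans subsetD)
    have "ennreal \<eta> \<le> ennreal \<eta>\<^sub>1"
      using \<eta>(4) s(2) by (intro ennreal_leI) simp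
    then have "\<forall>x. hausdorff_dist (G x) (F x) < ennreal \<eta>\<^sub>1"
      using G(2) by (meson order_less_le_trans)
    then have hit: "\<exists>x\<in>E'. \<bar>y - x\<bar> < \<epsilon> / 2" if "y \<in> {e\<^sub>1..e\<^sub>2}" for y
      using hits[OF _ E'_inv close that] by blast
    have lower: "hausdorff_semidist {e\<^sub>1..e\<^sub>2} (U \<inter> minimal_union G) \<le> ennreal (\<epsilon> / 2)"
    proof (rule hausdorff_semidist_le)
      fix y assume "y \<in> {e\<^sub>1..e\<^sub>2}"
      then obtain x where "x \<in> E'" "\<bar>y - x\<bar> < \<epsilon> / 2"
        using hit by blast
      moreover have "E' \<subseteq> U \<inter> minimal_union G"
        using E' by (auto simp: minimal_union_def)
      ultimately show "\<exists>x\<in>U \<inter> minimal_union G. \<bar>y - x\<bar> \<le> \<epsilon> / 2"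
        by (meson less_imp_le subsetD)
    qed
    have "hausdorff_dist (U \<inter> minimal_union G) {e\<^sub>1..e\<^sub>2} \<le> ennreal (\<epsilon> / 2)"
      using upper lower by (simp add: hausdorff_dist_def)
    also have "\<dots> < ennreal \<epsilon>"
      using \<epsilon> by (simp add: ennreal_lessI)
    finally show ?thesis by (simp add: MF)
  qed
  then show ?thesis
    using \<eta>(1) by blast
qed

theorem corollary6:
  fixes A :: "real set"
    and F :: "real \<Rightarrow> real \<Rightarrow> real set"
    and \<alpha>\<^sub>0 e\<^sub>1 e\<^sub>2 :: real
  assumes "open A"
    and compact_valued: "\<And>\<alpha> x. \<alpha> \<in> A \<Longrightarrow> F \<alpha> x \<in> nonempty_compacts"
    and H1: "\<And>\<alpha> x. \<alpha> \<in> A \<Longrightarrow> is_interval (F \<alpha> x)"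
    and H2: "\<And>\<alpha>. \<alpha> \<in> A \<Longrightarrow> \<exists>\<epsilon>>0. \<forall>x. \<exists>a. {a..a + \<epsilon>} \<subseteq> F \<alpha> x"
    and H3_lower: "\<And>\<alpha>. \<alpha> \<in> A \<Longrightarrow> lower_map (F \<alpha>) C1_differentiable_on UNIV"
    and H3_upper: "\<And>\<alpha>. \<alpha> \<in> A \<Longrightarrow> upper_map (F \<alpha>) C1_differentiable_on UNIV"
    and H4: "\<And>\<alpha> x. \<alpha> \<in> A \<Longrightarrow>
      hausdorff_continuous_at (A \<times> UNIV) (\<lambda>(\<beta>, y). F \<beta> y) (\<alpha>, x)"
    and H5: "\<And>\<alpha> \<epsilon>. \<alpha> \<in> A \<Longrightarrow> \<epsilon> > 0 \<Longrightarrow>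
      \<forall>\<^sub>F \<beta> in at \<alpha> within A. \<forall>x. hausdorff_dist (F \<beta> x) (F \<alpha> x) < ennreal \<epsilon>"
    and "\<alpha>\<^sub>0 \<in> A"
    and "minimal_invariant (F \<alpha>\<^sub>0) {e\<^sub>1..e\<^sub>2}"
    and "topologically_bifurcates A F \<alpha>\<^sub>0 {e\<^sub>1..e\<^sub>2}"
  shows "\<bar>deriv (lower_map (F \<alpha>\<^sub>0)) e\<^sub>1\<bar> \<ge> 1 \<or> \<bar>deriv (upper_map (F \<alpha>\<^sub>0)) e\<^sub>1\<bar> \<ge> 1 \<or>
         \<bar>deriv (lower_map (F \<alpha>\<^sub>0)) e\<^sub>2\<bar> \<ge> 1 \<or> \<bar>deriv (upper_map (F \<alpha>\<^sub>0)) e\<^sub>2\<bar> \<ge> 1"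
proof (rule ccontr)
  assume neg: "\<not> ?thesis"
  let ?F = "F \<alpha>\<^sub>0"
  have diff: "f field_differentiable at x" if "f C1_differentiable_on UNIV" for f :: "real \<Rightarrow> real" and x
    using that unfolding C1_differentiable_on_def field_differentiable_def
      has_real_derivative_iff_has_vector_derivative by blast
  have cont: "continuous_interval_map (F \<alpha>)" if "\<alpha> \<in> A" for \<alpha>
    using compact_valued[OF that] H1[OF that] H3_lower[OF that] H3_upper[OF that]
    by (intro continuous_interval_mapI C1_differentiable_imp_continuous_on) auto
  have F: "continuous_interval_map ?F"
    using cont \<open>\<alpha>\<^sub>0 \<in> A\<close> .
  have E: "minimal_invariant ?F {e\<^sub>1..e\<^sub>2}" by fact
  have "e\<^sub>1 \<le> e\<^sub>2" and inv: "set_image ?F {e\<^sub>1..e\<^sub>2} = {e\<^sub>1..e\<^sub>2}"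
    using E by (auto simp: minimal_invariant_def nonempty_compacts_def)
  have ends: "e\<^sub>1 \<le> lower_map ?F x" "upper_map ?F x \<le> e\<^sub>2" if "x \<in> {e\<^sub>1..e\<^sub>2}" for x
  proof -
    have "lower_map ?F x \<in> ?F x" "upper_map ?F x \<in> ?F x"
      using F unfolding continuous_interval_map_def by auto
    moreover have "?F x \<subseteq> {e\<^sub>1..e\<^sub>2}"
      using inv that unfolding set_image_def by blast
    ultimately show "e\<^sub>1 \<le> lower_map ?F x" "upper_map ?F x \<le> e\<^sub>2" by auto
  qed
  have "\<exists>c d. 0 < c \<and> c < 1 \<and> 0 < d \<and> (\<forall>t x. 0 \<le> t \<longrightarrow> t \<le> d \<longrightarrow> x \<in> {e\<^sub>1 - t..e\<^sub>2 + t} \<longrightarrow>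
      e\<^sub>1 - c * t \<le> lower_map ?F x \<and> upper_map ?F x \<le> e\<^sub>2 + c * t)"
    using neg diff[OF H3_lower[OF \<open>\<alpha>\<^sub>0 \<in> A\<close>]] diff[OF H3_upper[OF \<open>\<alpha>\<^sub>0 \<in> A\<close>]] ends \<open>e\<^sub>1 \<le> e\<^sub>2\<close>
    by (intro endpoint_contraction) auto
  then obtain c d where c: "0 < c" "c < 1" and d: "0 < d"
    and contr: "\<And>t x. 0 \<le> t \<Longrightarrow> t \<le> d \<Longrightarrow> x \<in> {e\<^sub>1 - t..e\<^sub>2 + t} \<Longrightarrow>
      e\<^sub>1 - c * t \<le> lower_map ?F x \<and> upper_map ?F x \<le> e\<^sub>2 + c * t"
    by blast
  let ?U = "{e\<^sub>1 - d..e\<^sub>2 + d}"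
  have "hausdorff_continuous_at A (\<lambda>\<alpha>. ?U \<inter> minimal_union (F \<alpha>)) \<alpha>\<^sub>0"
    unfolding hausdorff_continuous_at_def
  proof (intro allI impI)
    fix \<epsilon> :: real assume "\<epsilon> > 0"
    then obtain \<eta> where \<eta>: "\<eta> > 0" and near: "\<And>G. continuous_interval_map G \<Longrightarrow>
        (\<forall>x. hausdorff_dist (G x) (?F x) < ennreal \<eta>) \<Longrightarrow>
        hausdorff_dist (?U \<inter> minimal_union G) (?U \<inter> minimal_union ?F) < ennreal \<epsilon>"
      using minimal_union_near[OF F E c d contr] by blast
    have "\<forall>\<^sub>F \<alpha> in at \<alpha>\<^sub>0 within A. \<alpha> \<in> A"
      by (simp add: eventually_at_filter)
    with H5[OF \<open>\<alpha>\<^sub>0 \<in> A\<close> \<eta>]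
    show "\<forall>\<^sub>F \<alpha> in at \<alpha>\<^sub>0 within A.
        hausdorff_dist (?U \<inter> minimal_union (F \<alpha>)) (?U \<inter> minimal_union ?F) < ennreal \<epsilon>"
      by eventually_elim (use cont near in blast)
  qed
  moreover have "{e\<^sub>1..e\<^sub>2} \<subseteq> interior ?U"
    using d by auto
  ultimately show False
    using \<open>topologically_bifurcates A F \<alpha>\<^sub>0 {e\<^sub>1..e\<^sub>2}\<close> unfolding topologically_bifurcates_def by blast
qed

end
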